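(* Let $p$ be a prime and let $f(n)=g_1(n)g_2(n)\cdots g_r(n)$, where each $g_i(n)\in\mathbb{Z}[n]$ is a nonzero polynomial for $1\le i\le r$. Suppose that for some $1\le j\le r$ the polynomial $g_j(n)$ has a root in $\mathbb{Z}_p$, with $p$-adic expansion $$c_0+c_1p+c_2p^2+\cdots,\qquad 0\le c_k\le p-1 \text{ for all } k\ge 0.$$ Then, on the $p$-adic valuation tree of $\{\nu_p(f(n))\}_{n\ge 0}$, the nodes of the form $c_0+c_1p+\cdots+c_tp^t+np^{t+1}$ are non-terminating for all $t\ge 0$.
   Context: For a prime $p$, $\nu_p$ is the usual $p$-adic valuation on $\mathbb{Q}$, with $\nu_p(0)=+\infty$; $\mathbb{Z}_p$ is the ring of $p$-adic integers. Valuation tree. Given a sequence of rational numbers $\{S_n\}_{n\ge 0}$, the $p$-adic valuation tree of $\{\nu_p(S_n)\}_{n\ge 0}$ is built as follows. The $0$-th level has a single node, containing all terms of the sequence. A node at level $k$ consists of the terms $S_m$ whose index $m$ has the form $m=c_0+c_1p+\cdots+c_{k-1}p^{k-1}+np^k$, $n\ge 0$, for fixed digits $0\le c_i\le p-1$ (this is "the node of the form $c_0+\cdots+c_{k-1}p^{k-1}+np^k$"). A node is terminating if $\nu_p(S_m)$ has the same value for all terms $S_m$ in the node; it is non-terminating if at least two terms in the node have different valuations. A terminating node does not split. A non-terminating node at level $k$ splits into the $p$ nodes at level $k+1$ whose indices are $m=c_0+\cdots+c_{k-1}p^{k-1}+c_kp^k+np^{k+1}$, $n\ge 0$, one for each $0\le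 c_k\le p-1$. *)

theory Defs
  imports
    "HOL-Algebra.Ideal"
    "HOL-Computational_Algebra.Computational_Algebra"
    "HOL-Library.Extended"
begin

section \<open>The ring of p-adic integers\<close>

text \<open>
  $\mathbb{Z}_p$ is the inverse limit of the rings $\mathbb{Z}/p^k\mathbb{Z}$: an element is a
  sequence whose \<open>k\<close>-th entry is the canonical representative in $[0, p^k)$ of a residue class
  modulo $p^k$, compatibly with the projections.
\<close>

definition Zp :: "nat \<Rightarrow> (nat \<Rightarrow> int) ring" where
  "Zp p = \<lparr>
     carrier = {x. \<forall>k. 0 \<le> x k \<and> x k < int p ^ k \<and> x (Suc k) mod int p ^ k = x k},
     monoid.mult = (\<lambda>x y k. (x k * y k) mod int p ^ k),
     one = (\<lambda>k. 1 mod int p ^ k),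
     zero = (\<lambda>k. 0),
     add = (\<lambda>x y k. (x k + y k) mod int p ^ k)\<rparr>"

definition Zp_of_int :: "nat \<Rightarrow> int \<Rightarrow> nat \<Rightarrow> int" where
  "Zp_of_int p a = (\<lambda>k. a mod int p ^ k)"

lemma mod_power_Suc_mod: "(a mod int p ^ Suc k) mod int p ^ k = a mod int p ^ k"
  by (simp add: mod_mod_cancel)

lemma Zp_of_int_closed: "prime p \<Longrightarrow> Zp_of_int p a \<in> carrier (Zp p)"
  unfolding Zp_def Zp_of_int_def
  by (simp add: mod_power_Suc_mod prime_gt_0_nat del: power_Suc)

lemma cring_Zp:
  assumes "prime p"
  shows "cring (Zp p)"
proof -
  have pos: "int p ^ k > 0" for k
    using assms by (simp add: prime_gt_0_nat)
  have add_closed: "x \<oplus>\<^bsub>Zp p\<^esub> y \<in> carrier (Zp p)"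
    if "x \<in> carrier (Zp p)" "y \<in> carrier (Zp p)" for x y
  proof -
    have "(x (Suc k) + y (Suc k)) mod int p ^ k = (x k + y k) mod int p ^ k" for k
      using that unfolding Zp_def by (simp del: power_Suc) (metis mod_add_eq)
    then show ?thesis
      using pos unfolding Zp_def by (simp add: mod_power_Suc_mod del: power_Suc)
  qed
  have mult_closed: "x \<otimes>\<^bsub>Zp p\<^esub> y \<in> carrier (Zp p)"
    if "x \<in> carrier (Zp p)" "y \<in> carrier (Zp p)" for x y
  proof -
    have "(x (Suc k) * y (Suc k)) mod int p ^ k = (x k * y k) mod int p ^ k" for k
      using that unfolding Zp_def by (simp del: power_Suc) (metis mod_mult_eq)
    then show ?thesis
      using pos unfolding Zp_def by (simp add: mod_power_Suc_mod del: power_Suc)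
  qed
  have one_closed: "\<one>\<^bsub>Zp p\<^esub> \<in> carrier (Zp p)"
    using Zp_of_int_closed[OF assms, of 1] by (simp add: Zp_def Zp_of_int_def)
  have zero_closed: "\<zero>\<^bsub>Zp p\<^esub> \<in> carrier (Zp p)"
    using Zp_of_int_closed[OF assms, of 0] by (simp add: Zp_def Zp_of_int_def)
  have neg: "\<exists>y\<in>carrier (Zp p). y \<oplus>\<^bsub>Zp p\<^esub> x = \<zero>\<^bsub>Zp p\<^esub>"
    if "x \<in> carrier (Zp p)" for x
  proof (rule bexI)
    have "(- x (Suc k)) mod int p ^ k = (- x k) mod int p ^ k" for k
      using that unfolding Zp_def by (simp del: power_Suc) (metis mod_minus_eq)
    then show "(\<lambda>k. (- x k) mod int p ^ k) \<in> carrier (Zp p)"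
      using pos unfolding Zp_def by (simp add: mod_power_Suc_mod del: power_Suc)
    show "(\<lambda>k. (- x k) mod int p ^ k) \<oplus>\<^bsub>Zp p\<^esub> x = \<zero>\<^bsub>Zp p\<^esub>"
      by (simp add: Zp_def mod_simps)
  qed
  have red: "x k mod int p ^ k = x k" if "x \<in> carrier (Zp p)" for x k
    using that by (simp add: Zp_def)
  show ?thesis
  proof (rule cringI)
    show "abelian_group (Zp p)"
      by (rule abelian_groupI)
        (use add_closed zero_closed neg red in
          \<open>auto simp: Zp_def fun_eq_iff mod_simps algebra_simps\<close>)
    show "Group.comm_monoid (Zp p)"
      by (rule comm_monoidI)
        (use mult_closed one_closed red in
          \<open>auto simp: Zp_def fun_eq_iff mod_simps algebra_simps\<close>)
  qed (auto simp: Zp_def fun_eq_iff mod_simps algebra_simps)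
qed

definition Zp_poly :: "nat \<Rightarrow> int poly \<Rightarrow> (nat \<Rightarrow> int) \<Rightarrow> nat \<Rightarrow> int" where
  "Zp_poly p g x =
     (\<Oplus>\<^bsub>Zp p\<^esub>i\<in>{..degree g}. Zp_of_int p (coeff g i) \<otimes>\<^bsub>Zp p\<^esub> x [^]\<^bsub>Zp p\<^esub> i)"

definition Zp_root :: "nat \<Rightarrow> int poly \<Rightarrow> (nat \<Rightarrow> int) \<Rightarrow> bool" where
  "Zp_root p g x \<longleftrightarrow> x \<in> carrier (Zp p) \<and> Zp_poly p g x = \<zero>\<^bsub>Zp p\<^esub>"

text \<open>
  The expansion $x = \sum_k c_k p^k$: the partial sums converge to \<open>x\<close> in the p-adic topology,
  in which the ideals $p^N \mathbb{Z}_p$ form a basis of neighbourhoods of \<open>0\<close>.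
\<close>

definition Zp_expansion :: "nat \<Rightarrow> (nat \<Rightarrow> int) \<Rightarrow> (nat \<Rightarrow> nat) \<Rightarrow> bool" where
  "Zp_expansion p x c \<longleftrightarrow>
     (\<forall>k. c k \<le> p - 1) \<and>
     (\<forall>N. \<forall>\<^sub>F n in sequentially.
        x \<ominus>\<^bsub>Zp p\<^esub> Zp_of_int p (int (\<Sum>k<n. c k * p ^ k))
          \<in> PIdl\<^bsub>Zp p\<^esub> (Zp_of_int p (int p ^ N)))"


section \<open>The p-adic valuation tree of a sequence of rational numbers\<close>

definition padic_val :: "nat \<Rightarrow> rat \<Rightarrow> int extended" where
  "padic_val p q =
     (if q = 0 then Pinf
      else case quotient_of q of (a, b) \<Rightarrow>
        Fin (int (multiplicity (int p) a) - int (multiplicity (int p) b)))"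

text \<open>
  A node of level \<open>k\<close> is represented by its digits $[c_0, \ldots, c_{k-1}]$, least significant
  digit first; its terms are given by the following set of indices.
\<close>

definition node_indices :: "nat \<Rightarrow> nat list \<Rightarrow> nat set" where
  "node_indices p cs =
     {(\<Sum>i<length cs. cs ! i * p ^ i) + n * p ^ length cs | n. True}"

definition terminating :: "nat \<Rightarrow> (nat \<Rightarrow> rat) \<Rightarrow> nat list \<Rightarrow> bool" where
  "terminating p S cs \<longleftrightarrow>
     (\<forall>m\<in>node_indices p cs. \<forall>m'\<in>node_indices p cs. padic_val p (S m) = padic_val p (S m'))"

inductive_set val_tree :: "nat \<Rightarrow> (nat \<Rightarrow> rat) \<Rightarrow> nat list set"
  for p :: nat and S :: "nat \<Rightarrow> rat" where
  root: "[] \<in> val_tree p S"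
| split: "cs @ [c] \<in> val_tree p S"
    if "cs \<in> val_tree p S" and "\<not> terminating p S cs" and "c \<le> p - 1"

end

theory Submission
  imports Defs
begin

text \<open>
  Let \<open>s N = (\<Sum>k<N. c k * p ^ k)\<close> be the partial sums of the expansion of the root \<open>x\<close> of
  \<open>g j\<close>. In the inverse limit, the entry of \<open>x\<close> modulo \<open>p ^ N\<close> is \<open>s N\<close> modulo \<open>p ^ N\<close>
  (\<open>Zp_expansion_component\<close>), and a root of \<open>g j\<close> is a sequence of roots of \<open>g j\<close> modulo the
  powers \<open>p ^ N\<close> (\<open>Zp_root_dvd\<close>). Hence \<open>p ^ N\<close> divides \<open>g j (s N)\<close>, and therefore \<open>f (s N)\<close>,
  for every \<open>N\<close>.

  For \<open>N \<ge> k\<close>, all the integers \<open>s N\<close> are indices of the node of level \<open>k\<close> with digits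
  \<open>c 0, \<dots>, c (k - 1)\<close>, so the valuation of \<open>f\<close> is unbounded on this node. On the other hand, the
  node is infinite while the nonzero polynomial \<open>f\<close> has finitely many roots, so the valuation is
  finite at some index of the node. The node is therefore non-terminating. As this holds for every
  \<open>k \<ge> 0\<close>, each node of the path splits and the next one does belong to the tree.
\<close>

section \<open>Entries of p-adic integers\<close>

lemma Zp_add_component: "(x \<oplus>\<^bsub>Zp p\<^esub> y) k = (x k + y k) mod int p ^ k"
  by (simp add: Zp_def)

lemma Zp_mult_component: "(x \<otimes>\<^bsub>Zp p\<^esub> y) k = (x k * y k) mod int p ^ k"
  by (simp add: Zp_def)

lemma Zp_one_component: "\<one>\<^bsub>Zp p\<^esub> k = 1 mod int p ^ k"
  by (simp add: Zp_def)

lemma Zp_zero_component: "\<zero>\<^bsub>Zp p\<^esub> k = 0"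
  by (simp add: Zp_def)

lemma Zp_carrier_mod: "x \<in> carrier (Zp p) \<Longrightarrow> x k mod int p ^ k = x k"
  by (simp add: Zp_def)

lemma Zp_pow_component: "(x [^]\<^bsub>Zp p\<^esub> (i::nat)) k = x k ^ i mod int p ^ k"
  by (induction i)
    (simp_all add: Zp_one_component Zp_mult_component nat_pow_def mod_simps mult.commute)

lemma Zp_finsum_component:
  assumes "prime p" and "finite A" and "F \<in> A \<rightarrow> carrier (Zp p)"
  shows "(\<Oplus>\<^bsub>Zp p\<^esub>i\<in>A. F i) k = (\<Sum>i\<in>A. F i k) mod int p ^ k"
proof -
  interpret cring "Zp p"
    by (rule cring_Zp[OF assms(1)])
  show ?thesis
    using assms(2,3)
  proof (induction A rule: finite_induct)
    case empty
    show ?case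
      by (simp add: Zp_zero_component)
  next
    case (insert a A)
    then have "(\<Oplus>\<^bsub>Zp p\<^esub>i\<in>insert a A. F i) = F a \<oplus>\<^bsub>Zp p\<^esub> (\<Oplus>\<^bsub>Zp p\<^esub>i\<in>A. F i)"
      by (intro finsum_insert) auto
    with insert show ?case
      by (simp add: Zp_add_component mod_simps)
  qed
qed

lemma Zp_poly_component:
  assumes "prime p" and "x \<in> carrier (Zp p)"
  shows "Zp_poly p g x k = poly g (x k) mod int p ^ k"
proof -
  interpret cring "Zp p"
    by (rule cring_Zp[OF assms(1)])
  have "(\<lambda>i. Zp_of_int p (coeff g i) \<otimes>\<^bsub>Zp p\<^esub> x [^]\<^bsub>Zp p\<^esub> i) \<in> {..degree g} \<rightarrow> carrier (Zp p)"
    using assms by (auto intro!: m_closed nat_pow_closed Zp_of_int_closed)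
  then have "Zp_poly p g x k =
      (\<Sum>i\<le>degree g. (Zp_of_int p (coeff g i) \<otimes>\<^bsub>Zp p\<^esub> x [^]\<^bsub>Zp p\<^esub> i) k) mod int p ^ k"
    unfolding Zp_poly_def by (intro Zp_finsum_component assms(1)) auto
  also have "\<dots> = (\<Sum>i\<le>degree g. (coeff g i * x k ^ i) mod int p ^ k) mod int p ^ k"
    by (simp add: Zp_mult_component Zp_pow_component Zp_of_int_def mod_simps)
  also have "\<dots> = poly g (x k) mod int p ^ k"
    by (simp add: mod_sum_eq poly_altdef)
  finally show ?thesis .
qed

text \<open>A p-adic root of \<open>g\<close> is a compatible system of roots of \<open>g\<close> modulo the powers of \<open>p\<close>.\<close>

lemma Zp_root_dvd:
  assumes "prime p" and "Zp_root p g x"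
  shows "int p ^ k dvd poly g (x k)"
  using assms Zp_poly_component[of p x g k]
  by (auto simp: Zp_root_def Zp_zero_component dvd_eq_mod_eq_0)

lemma PIdl_power_component:
  assumes "d \<in> PIdl\<^bsub>Zp p\<^esub> (Zp_of_int p (int p ^ k))"
  shows "d k = 0"
  using assms by (auto simp: cgenideal_def Zp_mult_component Zp_of_int_def)

lemma partial_sum_split:
  fixes c :: "nat \<Rightarrow> nat"
  assumes "k \<le> n"
  obtains b where "(\<Sum>i<n. c i * p ^ i) = (\<Sum>i<k. c i * p ^ i) + b * p ^ k"
proof -
  have "(\<Sum>i<n. c i * p ^ i) = (\<Sum>i<k. c i * p ^ i) + (\<Sum>i=k..<n. c i * p ^ i)"
    using assms by (metis atLeast0LessThan le0 sum.atLeastLessThan_concat)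
  moreover have "p ^ k dvd (\<Sum>i=k..<n. c i * p ^ i)"
    by (auto intro!: dvd_sum dvd_mult le_imp_power_dvd)
  ultimately show thesis
    using that by (metis dvd_def mult.commute)
qed

text \<open>
  Convergence gives the congruence modulo \<open>p ^ k\<close> for a partial sum with \<open>n \<ge> k\<close> terms; its terms
  from the \<open>k\<close>-th on vanish modulo \<open>p ^ k\<close>.
\<close>

lemma Zp_expansion_component:
  assumes "prime p" and x: "x \<in> carrier (Zp p)" and "Zp_expansion p x c"
  shows "x k = int (\<Sum>i<k. c i * p ^ i) mod int p ^ k"
proof -
  interpret cring "Zp p"
    by (rule cring_Zp[OF assms(1)])
  have "\<forall>\<^sub>F n in sequentially. x \<ominus>\<^bsub>Zp p\<^esub> Zp_of_int p (int (\<Sum>i<n. c i * p ^ i))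
          \<in> PIdl\<^bsub>Zp p\<^esub> (Zp_of_int p (int p ^ k))"
    using assms(3) by (auto simp: Zp_expansion_def)
  then have "\<forall>\<^sub>F n in sequentially. k \<le> n \<and>
          x \<ominus>\<^bsub>Zp p\<^esub> Zp_of_int p (int (\<Sum>i<n. c i * p ^ i))
          \<in> PIdl\<^bsub>Zp p\<^esub> (Zp_of_int p (int p ^ k))"
    using eventually_ge_at_top eventually_conj by blast
  then obtain n where "k \<le> n" and
    n: "x \<ominus>\<^bsub>Zp p\<^esub> Zp_of_int p (int (\<Sum>i<n. c i * p ^ i))
          \<in> PIdl\<^bsub>Zp p\<^esub> (Zp_of_int p (int p ^ k))"
    using eventually_happens'[OF sequentially_bot] by blast
  define y where "y = Zp_of_int p (int (\<Sum>i<n. c i * p ^ i))"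
  have y: "y \<in> carrier (Zp p)"
    unfolding y_def by (rule Zp_of_int_closed[OF assms(1)])
  have "x = (x \<ominus>\<^bsub>Zp p\<^esub> y) \<oplus>\<^bsub>Zp p\<^esub> y"
    using x y by (simp add: minus_eq a_assoc l_neg)
  then have "x k = ((x \<ominus>\<^bsub>Zp p\<^esub> y) k + y k) mod int p ^ k"
    by (metis Zp_add_component)
  also have "(x \<ominus>\<^bsub>Zp p\<^esub> y) k = 0"
    using n unfolding y_def by (rule PIdl_power_component)
  finally have "x k = int (\<Sum>i<n. c i * p ^ i) mod int p ^ k"
    by (simp add: y_def Zp_of_int_def)
  moreover obtain b where "(\<Sum>i<n. c i * p ^ i) = (\<Sum>i<k. c i * p ^ i) + b * p ^ k"
    using partial_sum_split[OF \<open>k \<le> n\<close>] .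
  ultimately show ?thesis
    by (simp del: of_nat_sum)
qed

lemma diff_dvd_poly_diff:
  fixes g :: "'a::comm_ring_1 poly"
  shows "a - b dvd poly g a - poly g b"
proof (induction g)
  case 0
  show ?case
    by simp
next
  case (pCons q g)
  have "poly (pCons q g) a - poly (pCons q g) b
      = a * (poly g a - poly g b) + (a - b) * poly g b"
    by (simp add: algebra_simps)
  with pCons show ?case
    by simp
qed

lemma Zp_root_expansion_dvd:
  assumes "prime p" and "Zp_root p g x" and "Zp_expansion p x c"
  shows "int p ^ k dvd poly g (int (\<Sum>i<k. c i * p ^ i))"
proof -
  let ?s = "int (\<Sum>i<k. c i * p ^ i)"
  have "x k = ?s mod int p ^ k"
    using assms by (intro Zp_expansion_component) (auto simp: Zp_root_def)
  then have "int p ^ k dvd ?s - x k"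
    by (simp only: minus_mod_eq_mult_div dvd_triv_left)
  then have "int p ^ k dvd poly g ?s - poly g (x k)"
    by (rule dvd_trans[OF _ diff_dvd_poly_diff])
  from dvd_add[OF this Zp_root_dvd[OF assms(1,2), of k]] show ?thesis
    by (simp del: of_nat_sum)
qed

section \<open>Nodes with unbounded valuation\<close>

lemma padic_val_of_int:
  "padic_val p (of_int a) = (if a = 0 then Pinf else Fin (int (multiplicity (int p) a)))"
  using quotient_of_int[of a] by (simp add: padic_val_def Rat.of_int_def)

lemma node_indices_prefix:
  "node_indices p (map c [0..<k]) = {(\<Sum>i<k. c i * p ^ i) + n * p ^ k | n. True}"
  by (simp add: node_indices_def)

lemma partial_sum_in_node:
  assumes "k \<le> n"
  shows "(\<Sum>i<n. c i * p ^ i) \<in> node_indices p (map c [0..<k])"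
  using partial_sum_split[OF assms, of c p] by (auto simp: node_indices_prefix)

lemma infinite_node_indices:
  assumes "p > 0"
  shows "infinite (node_indices p cs)"
proof -
  have "inj (\<lambda>n. (\<Sum>i<length cs. cs ! i * p ^ i) + n * p ^ length cs)"
    using assms by (auto intro!: injI)
  then have "infinite (range (\<lambda>n. (\<Sum>i<length cs. cs ! i * p ^ i) + n * p ^ length cs))"
    by (rule range_inj_infinite)
  then show ?thesis
    by (simp add: node_indices_def full_SetCompr_eq)
qed

lemma ex_node_index_nonroot:
  fixes f :: "int poly"
  assumes "p > 0" and "f \<noteq> 0"
  obtains m where "m \<in> node_indices p cs" and "poly f (int m) \<noteq> 0"
proof -
  have "finite (int -` {z. poly f z = 0})"
    using poly_roots_finite[OF assms(2)] by (intro finite_vimageI) auto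
  then have "\<not> node_indices p cs \<subseteq> int -` {z. poly f z = 0}"
    using infinite_node_indices[OF assms(1)] finite_subset by blast
  then show thesis
    using that by auto
qed

text \<open>
  The valuation is unbounded along the partial sums, all but finitely many of which are indices of
  the node, but is finite at any index that is not a root of \<open>f\<close>.
\<close>

lemma not_terminating_prefix:
  fixes f :: "int poly"
  assumes "prime p" and "f \<noteq> 0"
    and dvd: "\<And>N. int p ^ N dvd poly f (int (\<Sum>i<N. c i * p ^ i))"
  shows "\<not> terminating p (\<lambda>n. of_int (poly f (int n))) (map c [0..<k])"
proof
  assume same: "terminating p (\<lambda>n. of_int (poly f (int n))) (map c [0..<k])"
  obtain m where m: "m \<in> node_indices p (map c [0..<k])" and nz: "poly f (int m) \<noteq> 0"
    using ex_node_index_nonroot assms(1,2) prime_gt_0_nat by metis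
  define v where "v = multiplicity (int p) (poly f (int m))"
  \<comment> \<open>An index of the node at which the valuation exceeds the finite valuation \<open>v\<close> at \<open>m\<close>.\<close>
  define N where "N = max k (Suc v)"
  let ?s = "\<Sum>i<N. c i * p ^ i"
  have "?s \<in> node_indices p (map c [0..<k])"
    by (rule partial_sum_in_node) (simp add: N_def)
  with same m have "padic_val p (of_int (poly f (int ?s))) = padic_val p (of_int (poly f (int m)))"
    unfolding terminating_def by blast
  with nz have s: "poly f (int ?s) \<noteq> 0" "multiplicity (int p) (poly f (int ?s)) = v"
    by (auto simp: padic_val_of_int v_def simp del: of_nat_sum split: if_splits)
  have "\<not> is_unit (int p)"
    using prime_gt_1_nat[OF assms(1)] by simp
  with s(1) dvd[of N] have "N \<le> multiplicity (int p) (poly f (int ?s))"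
    by (intro multiplicity_geI) auto
  with s(2) show False
    by (simp add: N_def)
qed

lemma prefix_in_val_tree:
  assumes "\<And>k. \<not> terminating p S (map c [0..<k])" and "\<And>k. c k \<le> p - 1"
  shows "map c [0..<k] \<in> val_tree p S"
proof (induction k)
  case 0
  show ?case
    by (simp add: val_tree.root)
next
  case (Suc k)
  with assms show ?case
    by (simp add: val_tree.split)
qed

theorem proposition6p1:
  fixes p r j :: nat
    and g :: "nat \<Rightarrow> int poly"
    and f :: "int poly"
    and x :: "nat \<Rightarrow> int"
    and c :: "nat \<Rightarrow> nat"
  assumes "prime p"
    and "\<And>i. i \<in> {1..r} \<Longrightarrow> g i \<noteq> 0"
    and "f = (\<Prod>i=1..r. g i)"
    and "j \<in> {1..r}"
    and "Zp_root p (g j) x"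
    and "Zp_expansion p x c"
  shows "\<forall>t. map c [0..<Suc t] \<in> val_tree p (\<lambda>n. of_int (poly f (int n))) \<and>
             \<not> terminating p (\<lambda>n. of_int (poly f (int n))) (map c [0..<Suc t])"
proof -
  have "f \<noteq> 0"
    using assms(2,3) by simp
  moreover have "int p ^ N dvd poly f (int (\<Sum>i<N. c i * p ^ i))" for N
  proof -
    have "int p ^ N dvd poly (g j) (int (\<Sum>i<N. c i * p ^ i))"
      using Zp_root_expansion_dvd[OF assms(1,5,6)] .
    also have "\<dots> dvd poly f (int (\<Sum>i<N. c i * p ^ i))"
      unfolding assms(3) poly_prod using assms(4) by (intro dvd_prodI) auto
    finally show ?thesis .
  qed
  ultimately have "\<not> terminating p (\<lambda>n. of_int (poly f (int n))) (map c [0..<k])" for k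
    using assms(1) by (intro not_terminating_prefix)
  moreover from this have "map c [0..<k] \<in> val_tree p (\<lambda>n. of_int (poly f (int n)))" for k
    using assms(6) by (intro prefix_in_val_tree) (auto simp: Zp_expansion_def)
  ultimately show ?thesis
    by blast
qed

end
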